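(* Let $n\geq 1$ be an integer and let $0\le m<n$ be an integer coprime with $n$. Let $\mathrm{Stab}_{[m:n:m]}\subset B_4$ be the stabilizer of the point $[m:n:m]\in\mathbb{P}^2(\mathbb{Q})$ for the action of $B_4$ through the integral reduced Burau representation $\rho$, and let $\mathcal{BI}_4=\ker\rho$. Then $$\mathrm{Stab}_{[m:n:m]}/\mathcal{BI}_4=\begin{cases}\langle \tau_1\Delta,\ \sigma_2\rangle & \text{if } n\ge 3,\\ \langle \tau_1\Delta,\ \sigma_2,\ \sigma_1\sigma_2^2\sigma_3\rangle & \text{if } n=2,\\ \langle \tau_1,\ \Delta,\ \sigma_2\rangle & \text{if } n=1,\end{cases}$$ where $\langle\cdots\rangle$ denotes the subgroup of the quotient generated by the classes modulo $\mathcal{BI}_4$ of the listed braids.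
   Context: $B_4$ is the braid group generated by $\sigma_1,\sigma_2,\sigma_3$ with relations $\sigma_1\sigma_2\sigma_1=\sigma_2\sigma_1\sigma_2$, $\sigma_2\sigma_3\sigma_2=\sigma_3\sigma_2\sigma_3$, $\sigma_1\sigma_3=\sigma_3\sigma_1$. The integral reduced Burau representation is the homomorphism $\rho:B_4\to \mathrm{SL}_3(\mathbb{Z})$ given by $$\rho(\sigma_1)=\begin{pmatrix}1&1&0\\0&1&0\\0&0&1\end{pmatrix},\quad \rho(\sigma_2)=\begin{pmatrix}1&0&0\\-1&1&1\\0&0&1\end{pmatrix},\quad \rho(\sigma_3)=\begin{pmatrix}1&0&0\\0&1&0\\0&-1&1\end{pmatrix},$$ acting on $\mathbb{P}^2(\mathbb{Q})$ by matrix multiplication on column vectors of homogeneous coordinates $[r:s:t]$. The braid Torelli group $\mathcal{BI}_4$ is the kernel of $\rho:B_4\to\mathrm{SL}_3(\mathbb{Z})$; it is a normal subgroup contained in every stabilizer. Notation: $\tau_1=(\sigma_1\sigma_2\sigma_1)^2$ and $\Delta=\sigma_1\sigma_2\sigma_3\sigma_1\sigma_2\sigma_1$. *)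

theory Defs
  imports "HOL-Analysis.Analysis" "HOL-Algebra.Algebra"
begin

section \<open>The braid group on four strands\<close>

datatype artin_gen = G1 | G2 | G3

text \<open>A word in the Artin generators; the letter \<open>(i, True)\<close> stands for the generator \<open>i\<close> and
  \<open>(i, False)\<close> for its formal inverse.\<close>

type_synonym braid_word = "(artin_gen \<times> bool) list"

definition pos_word :: "artin_gen list \<Rightarrow> braid_word" where
  "pos_word = map (\<lambda>i. (i, True))"

definition inv_word :: "braid_word \<Rightarrow> braid_word" where
  "inv_word w = rev (map (\<lambda>(i, b). (i, \<not> b)) w)"

inductive braid_eq :: "braid_word \<Rightarrow> braid_word \<Rightarrow> bool" where
  refl: "braid_eq u u"
| sym: "braid_eq u v \<Longrightarrow> braid_eq v u"
| trans: "braid_eq u v \<Longrightarrow> braid_eq v w \<Longrightarrow> braid_eq u w"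
| cong: "braid_eq u u' \<Longrightarrow> braid_eq v v' \<Longrightarrow> braid_eq (u @ v) (u' @ v')"
| cancel: "braid_eq [(i, b), (i, \<not> b)] []"
| braid12: "braid_eq (pos_word [G1, G2, G1]) (pos_word [G2, G1, G2])"
| braid23: "braid_eq (pos_word [G2, G3, G2]) (pos_word [G3, G2, G3])"
| comm13: "braid_eq (pos_word [G1, G3]) (pos_word [G3, G1])"

quotient_type braid4 = braid_word / braid_eq
  by (rule equivpI) (auto simp: reflp_def symp_def transp_def
      intro: braid_eq.refl braid_eq.sym braid_eq.trans)

lift_definition braid_mult :: "braid4 \<Rightarrow> braid4 \<Rightarrow> braid4" is "(@)"
  by (rule braid_eq.cong)

lift_definition braid_one :: braid4 is "[]" .

definition B4 :: "braid4 monoid" where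
  "B4 = \<lparr>carrier = UNIV, mult = braid_mult, one = braid_one\<rparr>"

lift_definition artin :: "artin_gen \<Rightarrow> braid4" is "\<lambda>i. [(i, True)]" .

abbreviation "\<sigma>\<^sub>1 \<equiv> artin G1"
abbreviation "\<sigma>\<^sub>2 \<equiv> artin G2"
abbreviation "\<sigma>\<^sub>3 \<equiv> artin G3"

lemma inv_word_left: "braid_eq (inv_word w @ w) []"
proof (induction w)
  case Nil
  show ?case by (simp add: inv_word_def braid_eq.refl)
next
  case (Cons x w)
  obtain i b where x: "x = (i, b)" by (cases x)
  have "braid_eq [(i, \<not> b), (i, b)] []"
    using braid_eq.cancel[of i "\<not> b"] by simp
  then have "braid_eq ([(i, \<not> b), (i, b)] @ w) ([] @ w)"
    by (rule braid_eq.cong[OF _ braid_eq.refl])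
  then have "braid_eq (inv_word w @ ([(i, \<not> b), (i, b)] @ w)) (inv_word w @ ([] @ w))"
    by (rule braid_eq.cong[OF braid_eq.refl])
  then have "braid_eq (inv_word (x # w) @ x # w) (inv_word w @ w)"
    by (simp add: inv_word_def x)
  with Cons show ?case
    by (blast intro: braid_eq.trans)
qed

lemma group_B4: "group B4"
proof (rule groupI)
  fix x assume "x \<in> carrier B4"
  show "\<exists>y\<in>carrier B4. y \<otimes>\<^bsub>B4\<^esub> x = \<one>\<^bsub>B4\<^esub>"
    unfolding B4_def by (simp, transfer) (use inv_word_left in blast)
next
  fix x y z
  show "x \<otimes>\<^bsub>B4\<^esub> y \<otimes>\<^bsub>B4\<^esub> z = x \<otimes>\<^bsub>B4\<^esub> (y \<otimes>\<^bsub>B4\<^esub> z)"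
    unfolding B4_def by (simp, transfer) (simp add: braid_eq.refl)
next
  fix x
  show "\<one>\<^bsub>B4\<^esub> \<otimes>\<^bsub>B4\<^esub> x = x"
    unfolding B4_def by (simp, transfer) (simp add: braid_eq.refl)
qed (simp_all add: B4_def)

lemma artin_relations:
  "\<sigma>\<^sub>1 \<otimes>\<^bsub>B4\<^esub> \<sigma>\<^sub>2 \<otimes>\<^bsub>B4\<^esub> \<sigma>\<^sub>1 = \<sigma>\<^sub>2 \<otimes>\<^bsub>B4\<^esub> \<sigma>\<^sub>1 \<otimes>\<^bsub>B4\<^esub> \<sigma>\<^sub>2"
  "\<sigma>\<^sub>2 \<otimes>\<^bsub>B4\<^esub> \<sigma>\<^sub>3 \<otimes>\<^bsub>B4\<^esub> \<sigma>\<^sub>2 = \<sigma>\<^sub>3 \<otimes>\<^bsub>B4\<^esub> \<sigma>\<^sub>2 \<otimes>\<^bsub>B4\<^esub> \<sigma>\<^sub>3"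
  "\<sigma>\<^sub>1 \<otimes>\<^bsub>B4\<^esub> \<sigma>\<^sub>3 = \<sigma>\<^sub>3 \<otimes>\<^bsub>B4\<^esub> \<sigma>\<^sub>1"
  unfolding B4_def
  by (simp_all, (transfer, use braid_eq.braid12 braid_eq.braid23 braid_eq.comm13
      in \<open>simp add: pos_word_def\<close>)+)

definition \<tau>\<^sub>1 :: braid4 where
  "\<tau>\<^sub>1 = (\<sigma>\<^sub>1 \<otimes>\<^bsub>B4\<^esub> \<sigma>\<^sub>2 \<otimes>\<^bsub>B4\<^esub> \<sigma>\<^sub>1) [^]\<^bsub>B4\<^esub> (2::nat)"

definition \<Delta> :: braid4 where
  "\<Delta> = \<sigma>\<^sub>1 \<otimes>\<^bsub>B4\<^esub> \<sigma>\<^sub>2 \<otimes>\<^bsub>B4\<^esub> \<sigma>\<^sub>3 \<otimes>\<^bsub>B4\<^esub> \<sigma>\<^sub>1 \<otimes>\<^bsub>B4\<^esub> \<sigma>\<^sub>2 \<otimes>\<^bsub>B4\<^esub> \<sigma>\<^sub>1"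


section \<open>The integral reduced Burau representation\<close>

definition SL3Z :: "(int^3^3) monoid" where
  "SL3Z = \<lparr>carrier = {A. det A = 1}, mult = (**), one = mat 1\<rparr>"

definition adjugate3 :: "int^3^3 \<Rightarrow> int^3^3" where
  "adjugate3 A = vector [
     vector [A$2$2 * A$3$3 - A$2$3 * A$3$2, A$1$3 * A$3$2 - A$1$2 * A$3$3, A$1$2 * A$2$3 - A$1$3 * A$2$2],
     vector [A$2$3 * A$3$1 - A$2$1 * A$3$3, A$1$1 * A$3$3 - A$1$3 * A$3$1, A$1$3 * A$2$1 - A$1$1 * A$2$3],
     vector [A$2$1 * A$3$2 - A$2$2 * A$3$1, A$1$2 * A$3$1 - A$1$1 * A$3$2, A$1$1 * A$2$2 - A$1$2 * A$2$1]]"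

lemma adjugate3_left: "det A = 1 \<Longrightarrow> adjugate3 A ** A = mat 1"
  unfolding adjugate3_def det_3
  by (simp add: vec_eq_iff matrix_matrix_mult_def mat_def forall_3 sum_3 vector_3)
     (simp add: algebra_simps)

lemma group_SL3Z: "group SL3Z"
proof (rule groupI)
  fix A assume A: "A \<in> carrier SL3Z"
  then have "adjugate3 A ** A = mat 1"
    by (simp add: SL3Z_def adjugate3_left)
  moreover from this have "det (adjugate3 A) * det A = 1"
    by (metis det_I det_mul)
  ultimately show "\<exists>B\<in>carrier SL3Z. B \<otimes>\<^bsub>SL3Z\<^esub> A = \<one>\<^bsub>SL3Z\<^esub>"
    using A by (auto simp: SL3Z_def intro!: bexI[of _ "adjugate3 A"])
qed (auto simp: SL3Z_def det_mul matrix_mul_assoc)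

fun burau_gen :: "artin_gen \<Rightarrow> int^3^3" where
  "burau_gen G1 = vector [vector [1, 1, 0], vector [0, 1, 0], vector [0, 0, 1]]"
| "burau_gen G2 = vector [vector [1, 0, 0], vector [-1, 1, 1], vector [0, 0, 1]]"
| "burau_gen G3 = vector [vector [1, 0, 0], vector [0, 1, 0], vector [0, -1, 1]]"

fun burau_letter :: "artin_gen \<times> bool \<Rightarrow> int^3^3" where
  "burau_letter (i, b) = (if b then burau_gen i else inv\<^bsub>SL3Z\<^esub> (burau_gen i))"

fun burau_word :: "braid_word \<Rightarrow> int^3^3" where
  "burau_word [] = \<one>\<^bsub>SL3Z\<^esub>"
| "burau_word (x # w) = burau_letter x \<otimes>\<^bsub>SL3Z\<^esub> burau_word w"

lemma burau_gen_closed: "burau_gen i \<in> carrier SL3Z"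
  by (cases i) (simp_all add: SL3Z_def det_3)

lemma burau_letter_closed: "burau_letter x \<in> carrier SL3Z"
  using group.inv_closed[OF group_SL3Z burau_gen_closed] burau_gen_closed
  by (cases x) simp

lemma burau_word_closed: "burau_word w \<in> carrier SL3Z"
proof -
  interpret group SL3Z by (rule group_SL3Z)
  show ?thesis by (induction w) (simp_all add: burau_letter_closed del: burau_letter.simps)
qed

lemma burau_word_append: "burau_word (u @ v) = burau_word u \<otimes>\<^bsub>SL3Z\<^esub> burau_word v"
proof -
  interpret group SL3Z by (rule group_SL3Z)
  show ?thesis
    by (induction u)
       (simp_all add: burau_letter_closed burau_word_closed m_assoc del: burau_letter.simps)
qed

lemma burau_word_braid_eq: "braid_eq u v \<Longrightarrow> burau_word u = burau_word v"
proof (induction rule: braid_eq.induct)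
  case (cancel i b)
  interpret group SL3Z by (rule group_SL3Z)
  show ?case by (simp add: burau_gen_closed)
qed (simp_all add: burau_word_append pos_word_def SL3Z_def vec_eq_iff matrix_matrix_mult_def
      mat_def forall_3 sum_3 vector_3)

lift_definition burau :: "braid4 \<Rightarrow> int^3^3" is burau_word
  by (rule burau_word_braid_eq)

lemma burau_artin: "burau (artin i) = burau_gen i"
  by transfer (simp add: SL3Z_def)

lemma burau_hom: "burau \<in> hom B4 SL3Z"
  unfolding B4_def
  by (rule homI; simp; transfer) (simp_all add: burau_word_closed burau_word_append)

definition BI4 :: "braid4 set" where
  "BI4 = kernel B4 SL3Z burau"

lemma BI4_normal: "BI4 \<lhd> B4"
  unfolding BI4_def
  by (rule group_hom.normal_kernel)
     (simp add: group_hom_def group_hom_axioms_def group_B4 group_SL3Z burau_hom)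


section \<open>The action on the rational projective plane\<close>

text \<open>A point of the projective plane is the set of all its homogeneous coordinate vectors,
  that is, a line through the origin with the origin removed.\<close>

definition proj_point :: "rat^3 \<Rightarrow> (rat^3) set" where
  "proj_point v = {c *s v | c. c \<noteq> 0}"

definition P2Q :: "(rat^3) set set" where
  "P2Q = proj_point ` {v. v \<noteq> 0}"

abbreviation burau_rat :: "braid4 \<Rightarrow> rat^3^3" where
  "burau_rat g \<equiv> map_matrix rat_of_int (burau g)"

definition burau_action :: "braid4 \<Rightarrow> (rat^3) set \<Rightarrow> (rat^3) set" where
  "burau_action g = (\<lambda>P\<in>P2Q. (\<lambda>v. burau_rat g *v v) ` P)"

lemma burau_rat_mult: "burau_rat (g \<otimes>\<^bsub>B4\<^esub> h) = burau_rat g ** burau_rat h"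
  using hom_mult[OF burau_hom, of g h]
  by (simp add: B4_def SL3Z_def vec_eq_iff matrix_matrix_mult_def)

lemma burau_rat_one: "burau_rat \<one>\<^bsub>B4\<^esub> = mat 1"
  using hom_one[OF burau_hom group_B4 group_SL3Z]
  by (simp add: SL3Z_def vec_eq_iff mat_def)

lemma burau_rat_inv: "burau_rat (inv\<^bsub>B4\<^esub> g) ** burau_rat g = mat 1"
proof -
  interpret group B4 by (rule group_B4)
  have "g \<in> carrier B4" by (simp add: B4_def)
  then show ?thesis by (metis burau_rat_mult burau_rat_one l_inv)
qed

lemma burau_rat_nonzero: "v \<noteq> 0 \<Longrightarrow> burau_rat g *v v \<noteq> 0"
  by (metis burau_rat_inv matrix_vector_mul_assoc matrix_vector_mul_lid matrix_vector_mult_0_right)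

lemma burau_action_proj_point:
  assumes "v \<noteq> 0"
  shows "burau_action g (proj_point v) = proj_point (burau_rat g *v v)"
proof -
  have "proj_point v \<in> P2Q" using assms by (auto simp: P2Q_def)
  then have "burau_action g (proj_point v) = (\<lambda>v. burau_rat g *v v) ` proj_point v"
    by (simp add: burau_action_def)
  also have "\<dots> = proj_point (burau_rat g *v v)"
    by (fastforce simp: proj_point_def image_iff vector_scalar_commute)
  finally show ?thesis .
qed

lemma burau_action_closed: "P \<in> P2Q \<Longrightarrow> burau_action g P \<in> P2Q"
  by (auto simp: P2Q_def burau_action_proj_point burau_rat_nonzero)

lemma burau_action_mult:
  "P \<in> P2Q \<Longrightarrow> burau_action (g \<otimes>\<^bsub>B4\<^esub> h) P = burau_action g (burau_action h P)"
  by (auto simp: P2Q_def burau_action_proj_point burau_rat_nonzero burau_rat_mult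
      matrix_vector_mul_assoc)

lemma burau_action_one: "P \<in> P2Q \<Longrightarrow> burau_action \<one>\<^bsub>B4\<^esub> P = P"
  by (auto simp: P2Q_def burau_action_proj_point burau_rat_one)

lemma burau_group_action: "group_action B4 P2Q burau_action"
proof -
  interpret group B4 by (rule group_B4)
  have car: "g \<in> carrier B4" for g by (simp add: B4_def)
  have bij: "burau_action g \<in> Bij P2Q" for g
  proof -
    have "bij_betw (burau_action g) P2Q P2Q"
      by (rule bij_betw_byWitness[where f' = "burau_action (inv\<^bsub>B4\<^esub> g)"])
         (auto simp: burau_action_closed burau_action_mult[symmetric] car burau_action_one)
    then show ?thesis by (simp add: Bij_def burau_action_def)
  qed
  have "burau_action (g \<otimes>\<^bsub>B4\<^esub> h) = compose P2Q (burau_action g) (burau_action h)" for g h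
  proof
    fix P
    show "burau_action (g \<otimes>\<^bsub>B4\<^esub> h) P = compose P2Q (burau_action g) (burau_action h) P"
      by (cases "P \<in> P2Q") (simp_all add: compose_def burau_action_mult, simp add: burau_action_def)
  qed
  then have "burau_action \<in> hom B4 (BijGroup P2Q)"
    by (intro homI) (auto simp: BijGroup_def bij)
  then show ?thesis
    by (simp add: group_action_def group_hom_def group_hom_axioms_def group_B4 group_BijGroup)
qed

definition homog :: "int \<Rightarrow> int \<Rightarrow> int \<Rightarrow> (rat^3) set" where
  "homog r s t = proj_point (vector [rat_of_int r, rat_of_int s, rat_of_int t])"

abbreviation Stab :: "(rat^3) set \<Rightarrow> braid4 set" where
  "Stab P \<equiv> stabilizer B4 burau_action P"

lemma BI4_subset_Stab: "P \<in> P2Q \<Longrightarrow> BI4 \<subseteq> Stab P"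
proof -
  have "burau_rat g = mat 1" if "g \<in> BI4" for g
    using that by (simp add: BI4_def kernel_def SL3Z_def vec_eq_iff mat_def)
  then show "P \<in> P2Q \<Longrightarrow> BI4 \<subseteq> Stab P"
    by (auto simp: P2Q_def stabilizer_def B4_def burau_action_proj_point)
qed

lemma homog_in_P2Q: "r \<noteq> 0 \<or> s \<noteq> 0 \<or> t \<noteq> 0 \<Longrightarrow> homog r s t \<in> P2Q"
  by (auto simp: homog_def P2Q_def vec_eq_iff forall_3 intro!: imageI)

text \<open>The quotient of a subgroup \<open>H\<close> of \<open>B4\<close> containing \<open>BI4\<close>, by \<open>BI4\<close>.  Its elements are cosets
  of \<open>BI4\<close> in \<open>H\<close>, hence also elements of \<open>B4 Mod BI4\<close>.\<close>

definition quot_BI4 :: "braid4 set \<Rightarrow> braid4 set monoid" where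
  "quot_BI4 H = (B4\<lparr>carrier := H\<rparr>) Mod BI4"

definition gen_mod_BI4 :: "braid4 set \<Rightarrow> braid4 set set" where
  "gen_mod_BI4 S = generate (B4 Mod BI4) ((\<lambda>g. BI4 #>\<^bsub>B4\<^esub> g) ` S)"

end

theory Submission
  imports Defs
begin

text \<open>The vector \<open>(1, 0, 1)\<close> is fixed by the whole image of \<open>\<rho>\<close>.  In the coordinates
  \<open>u = r - t\<close>, \<open>s\<close>, \<open>t\<close> a matrix of determinant 1 fixing it has the form \<open>(x, t) \<mapsto> (B x, t + \<phi> x)\<close>
  with \<open>x = (u, s)\<close>, \<open>B \<in> SL\<^sub>2(\<int>)\<close> and \<open>\<phi>\<close> a linear form.  If it maps \<open>(m, n, m)\<close>, that is
  \<open>x = (0, n)\<close>, \<open>t = m\<close>, to a multiple of itself, then the factor is \<open>1\<close> or \<open>-1\<close>.  For the factor 1 the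
  matrix is a shear \<open>s \<mapsto> s + p u\<close>, \<open>t \<mapsto> t + k u\<close>, and these form the group \<open>\<int>\<^sup>2\<close> generated by the
  images of \<open>\<sigma>\<^sub>2\<close> and \<open>\<tau>\<^sub>1\<Delta>\<close>.  For the factor \<open>-1\<close> one gets \<open>n dvd 2 * m\<close>, hence \<open>n \<le> 2\<close>,
  and one further generator suffices.\<close>

section \<open>Entries of the Burau matrices\<close>

lemma carrier_B4 [simp]: "g \<in> carrier B4"
  by (simp add: B4_def)

lemma burau_mult: "burau (g \<otimes>\<^bsub>B4\<^esub> h) = burau g ** burau h"
  using hom_mult[OF burau_hom, of g h] by (simp add: SL3Z_def)

lemma burau_one: "burau \<one>\<^bsub>B4\<^esub> = mat 1"
  using hom_one[OF burau_hom group_B4 group_SL3Z] by (simp add: SL3Z_def)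

lemma burau_inv_left: "burau (inv\<^bsub>B4\<^esub> g) ** burau g = mat 1"
  by (metis burau_mult burau_one carrier_B4 group.l_inv group_B4)

lemma det_burau: "det (burau g) = 1"
  using hom_in_carrier[OF burau_hom, of g] by (simp add: SL3Z_def)

lemma burau_letter_fixes: "burau_letter x *v vector [1, 0, 1] = vector [1, 0, 1]"
proof -
  obtain i b where x: "x = (i, b)" by (cases x)
  have fix_i: "burau_gen i *v vector [1, 0, 1] = vector [1, 0, 1]"
    by (cases i) (simp_all add: vec_eq_iff forall_3 matrix_vector_mult_def sum_3)
  have "inv\<^bsub>SL3Z\<^esub> (burau_gen i) ** burau_gen i = mat 1"
    using group.l_inv[OF group_SL3Z burau_gen_closed, of i] by (simp add: SL3Z_def)
  then have "inv\<^bsub>SL3Z\<^esub> (burau_gen i) *v vector [1, 0, 1] = vector [1, 0, 1]"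
    by (metis fix_i matrix_vector_mul_assoc matrix_vector_mul_lid)
  with fix_i show ?thesis by (simp add: x)
qed

lemma burau_fixes: "burau g *v vector [1, 0, 1] = vector [1, 0, 1]"
proof transfer
  show "burau_word w *v vector [1, 0, 1] = vector [1, 0, 1]" for w
    by (induction w)
       (simp_all add: SL3Z_def burau_letter_fixes flip: matrix_vector_mul_assoc
          del: burau_letter.simps)
qed

lemma burau_entries:
  "burau g $ 1 $ 3 = 1 - burau g $ 1 $ 1"
  "burau g $ 2 $ 3 = - burau g $ 2 $ 1"
  "burau g $ 3 $ 3 = 1 - burau g $ 3 $ 1"
  using burau_fixes[of g]
  by (simp_all add: vec_eq_iff forall_3 matrix_vector_mult_def sum_3 algebra_simps)

text \<open>The left side is the determinant of the block \<open>B\<close>, that is, of the action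
  on the coordinates \<open>u = r - t\<close> and \<open>s\<close> modulo the fixed vector.\<close>

lemma det_burau_entries:
  "(burau g $ 1 $ 1 - burau g $ 3 $ 1) * burau g $ 2 $ 2
    - (burau g $ 1 $ 2 - burau g $ 3 $ 2) * burau g $ 2 $ 1 = 1"
  using det_burau[of g] by (simp add: det_3 burau_entries algebra_simps)

section \<open>Stabilizers in terms of integer matrices\<close>

lemma mem_Stab_iff: "g \<in> Stab P \<longleftrightarrow> burau_action g P = P"
  by (simp add: stabilizer_def)

lemma proj_point_eq_iff:
  "proj_point v = proj_point w \<longleftrightarrow> (\<exists>c. c \<noteq> 0 \<and> v = c *s w)"
proof
  assume eq: "proj_point v = proj_point w"
  have "v \<in> proj_point v" by (auto simp: proj_point_def intro!: exI[of _ 1])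
  with eq show "\<exists>c. c \<noteq> 0 \<and> v = c *s w" by (auto simp: proj_point_def)
next
  assume "\<exists>c. c \<noteq> 0 \<and> v = c *s w"
  then obtain c where c: "c \<noteq> 0" "v = c *s w" by blast
  \<comment> \<open>Rescaling the parameter by \<open>c\<close> matches the two parametrisations of
    the same punctured line.\<close>
  have "d *s w = (d / c) *s v" "d *s v = (d * c) *s w" for d
    using c by (simp_all add: vector_smult_assoc)
  then show "proj_point v = proj_point w"
    unfolding proj_point_def using c(1)
    by (metis (no_types, lifting) divide_eq_0_iff mult_eq_0_iff)
qed

text \<open>The scaling factor is the integer entry \<open>burau g $ 2 $ 2\<close>, because the
  outer terms of the second row cancel on \<open>(m, n, m)\<close>. The determinant then forces it
  to be a unit.\<close>

lemma mem_Stab_homog_iff: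
  fixes m n :: int
  assumes "n \<ge> 1"
  shows "g \<in> Stab (homog m n m) \<longleftrightarrow>
    burau g *v vector [m, n, m] = vector [m, n, m] \<or>
    burau g *v vector [m, n, m] = - vector [m, n, m]"
    (is "_ \<longleftrightarrow> ?R")
proof -
  let ?v = "vector [rat_of_int m, rat_of_int n, rat_of_int m] :: rat^3"
  let ?A = "burau g"
  have v0: "?v \<noteq> 0" using assms by (auto simp: vec_eq_iff forall_3)
  have "g \<in> Stab (homog m n m) \<longleftrightarrow> (\<exists>c. c \<noteq> 0 \<and> burau_rat g *v ?v = c *s ?v)"
    by (simp add: mem_Stab_iff homog_def burau_action_proj_point v0 proj_point_eq_iff)
  also have "\<dots> \<longleftrightarrow> ?R"
  proof
    assume "\<exists>c. c \<noteq> 0 \<and> burau_rat g *v ?v = c *s ?v"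
    then obtain c where "burau_rat g *v ?v = c *s ?v" by blast
    then have eqs: "rat_of_int (m + ?A $ 1 $ 2 * n) = c * rat_of_int m"
      "rat_of_int (?A $ 2 $ 2 * n) = c * rat_of_int n"
      "rat_of_int (m + ?A $ 3 $ 2 * n) = c * rat_of_int m"
      by (simp_all add: vec_eq_iff forall_3 matrix_vector_mult_def sum_3 burau_entries
          algebra_simps)
    from eqs(2) have c: "c = rat_of_int (?A $ 2 $ 2)" using assms by simp
    have e: "m + ?A $ 1 $ 2 * n = ?A $ 2 $ 2 * m" "m + ?A $ 3 $ 2 * n = ?A $ 2 $ 2 * m"
      using eqs(1,3) unfolding c by (metis of_int_eq_iff of_int_mult)+
    then have "?A $ 1 $ 2 * n = ?A $ 3 $ 2 * n" by linarith
    then have "?A $ 1 $ 2 = ?A $ 3 $ 2" using assms by simp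
    \<comment> \<open>The block \<open>B\<close> is now triangular, so its diagonal entries multiply
      to 1.\<close>
    then have "(?A $ 1 $ 1 - ?A $ 3 $ 1) * ?A $ 2 $ 2 = 1"
      using det_burau_entries[of g] by simp
    then have "?A $ 2 $ 2 = 1 \<or> ?A $ 2 $ 2 = -1"
      by (metis mult.commute zmult_eq_1_iff)
    with e show ?R
      by (auto simp: vec_eq_iff forall_3 matrix_vector_mult_def sum_3 burau_entries algebra_simps)
  next
    assume R: ?R
    have "burau_rat g *v ?v = (\<chi> i. rat_of_int ((?A *v vector [m, n, m]) $ i))"
      by (simp add: vec_eq_iff forall_3 matrix_vector_mult_def sum_3)
    with R have "burau_rat g *v ?v = 1 *s ?v \<or> burau_rat g *v ?v = (-1) *s ?v"
      by (auto simp: vec_eq_iff forall_3)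
    then show "\<exists>c. c \<noteq> 0 \<and> burau_rat g *v ?v = c *s ?v"
      by (metis neg_equal_0_iff_equal one_neq_zero)
  qed
  finally show ?thesis .
qed

section \<open>The group of shears\<close>

definition shear :: "int \<Rightarrow> int \<Rightarrow> int^3^3" where
  "shear p k = vector [vector [1 + k, 0, - k], vector [p, 1, - p], vector [k, 0, 1 - k]]"

text \<open>\<open>shear p k\<close> is the identity plus the column \<open>(k, p, k)\<close> times
  the row \<open>(1, 0, -1)\<close>. The row annihilates every such column, so the parameters
  add.\<close>

lemma shear_mult: "shear p k ** shear q l = shear (p + q) (k + l)"
  by (simp add: shear_def vec_eq_iff forall_3 matrix_matrix_mult_def sum_3 algebra_simps)

lemma shear_zero: "shear 0 0 = mat 1"
  by (simp add: shear_def vec_eq_iff forall_3 mat_def)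

lemma burau_inv_shear:
  assumes "burau g = shear p k"
  shows "burau (inv\<^bsub>B4\<^esub> g) = shear (- p) (- k)"
proof -
  \<comment> \<open>The product is evaluated in two ways: either the first two factors cancel or the
    two shears do.\<close>
  have "burau (inv\<^bsub>B4\<^esub> g) ** (shear p k ** shear (- p) (- k)) = shear (- p) (- k)"
    using burau_inv_left[of g] by (simp add: assms matrix_mul_assoc)
  then show ?thesis by (simp add: shear_mult shear_zero)
qed

lemma burau_int_pow_shear:
  fixes j :: int
  assumes "burau g = shear p k"
  shows "burau (g [^]\<^bsub>B4\<^esub> j) = shear (j * p) (j * k)"
proof -
  interpret group B4 by (rule group_B4)
  have nat: "burau (g [^]\<^bsub>B4\<^esub> i) = shear (int i * p) (int i * k)" for i :: nat
    by (induction i) (simp_all add: burau_one burau_mult shear_mult shear_zero assms algebra_simps)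
  show ?thesis
  proof (cases j)
    case (nonneg i)
    then show ?thesis by (simp add: int_pow_int nat)
  next
    case (neg i)
    show ?thesis
      \<comment> \<open>Here \<open>j = - int (Suc i)\<close>, so the natural power
        \<open>Suc i\<close> is the one to invert.\<close>
      using burau_inv_shear[OF nat[of "Suc i"]]
      by (simp add: neg int_pow_neg int_pow_int del: of_nat_Suc nat_pow_Suc)
  qed
qed

section \<open>Matrices of the generating braids\<close>

lemma burau_\<tau>\<^sub>1: "burau \<tau>\<^sub>1 = vector [vector [-1, 0, 2], vector [0, -1, 0], vector [0, 0, 1]]"
proof -
  interpret group B4 by (rule group_B4)
  show ?thesis
    by (simp add: \<tau>\<^sub>1_def numeral_2_eq_2 burau_mult burau_artin)
       (simp add: vec_eq_iff forall_3 matrix_matrix_mult_def sum_3)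
qed

lemma burau_\<Delta>: "burau \<Delta> = vector [vector [0, 0, 1], vector [0, -1, 0], vector [1, 0, 0]]"
  by (simp add: \<Delta>_def burau_mult burau_artin)
     (simp add: vec_eq_iff forall_3 matrix_matrix_mult_def sum_3)

text \<open>In the coordinates \<open>u\<close>, \<open>s\<close>, \<open>t\<close> the matrix of
  \<open>\<tau>\<^sub>1\<close> is diagonal with entries -1, -1, 1, while \<open>\<Delta>\<close>
  negates \<open>u\<close> and \<open>s\<close> and sends \<open>t\<close> to \<open>t + u\<close>.
  The signs cancel in the product.\<close>

lemma burau_\<tau>\<^sub>1_\<Delta>: "burau (\<tau>\<^sub>1 \<otimes>\<^bsub>B4\<^esub> \<Delta>) = shear 0 1"
  by (simp add: burau_mult burau_\<tau>\<^sub>1 burau_\<Delta> shear_def)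
     (simp add: vec_eq_iff forall_3 matrix_matrix_mult_def sum_3)

lemma burau_\<sigma>\<^sub>2: "burau \<sigma>\<^sub>2 = shear (-1) 0"
  by (simp add: burau_artin shear_def)

text \<open>This braid supplies the factor -1 for \<open>n = 2\<close>: its matrix negates
  \<open>(1, 2, 1)\<close>.\<close>

lemma burau_\<sigma>\<^sub>1\<sigma>\<^sub>2\<sigma>\<^sub>2\<sigma>\<^sub>3:
  "burau (\<sigma>\<^sub>1 \<otimes>\<^bsub>B4\<^esub> \<sigma>\<^sub>2 [^]\<^bsub>B4\<^esub> (2::nat) \<otimes>\<^bsub>B4\<^esub> \<sigma>\<^sub>3) =
    vector [vector [-1, -1, 2], vector [-2, -1, 2], vector [0, -1, 1]]"
proof -
  interpret group B4 by (rule group_B4)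
  show ?thesis
    by (simp add: numeral_2_eq_2 burau_mult burau_artin)
       (simp add: vec_eq_iff forall_3 matrix_matrix_mult_def sum_3)
qed

lemma shear_fixes: "shear p k *v vector [m, n, m] = vector [m, n, m]"
  by (simp add: shear_def vec_eq_iff forall_3 matrix_vector_mult_def sum_3 algebra_simps)

text \<open>Since \<open>(m, n, m)\<close> is \<open>m\<close> times the fixed vector plus
  \<open>n\<close> times the second unit vector, the latter is fixed too. The determinant then makes
  \<open>B\<close> unipotent, and the first column carries both shear parameters.\<close>

lemma burau_eq_shear:
  assumes "n \<noteq> 0" and "burau g *v vector [m, n, m] = vector [m, n, m]"
  shows "burau g = shear (burau g $ 2 $ 1) (burau g $ 3 $ 1)"
proof -
  let ?A = "burau g"
  have e: "?A $ 1 $ 2 = 0" "?A $ 2 $ 2 = 1" "?A $ 3 $ 2 = 0"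
    using assms
    by (simp_all add: vec_eq_iff forall_3 matrix_vector_mult_def sum_3 burau_entries algebra_simps)
  then have "?A $ 1 $ 1 = 1 + ?A $ 3 $ 1"
    using det_burau_entries[of g] by simp
  then show ?thesis
    by (simp add: shear_def vec_eq_iff forall_3 burau_entries e)
qed

lemma shear_in_generate:
  assumes "a \<in> generate B4 S" "b \<in> generate B4 S" "burau a = shear 0 1" "burau b = shear (-1) 0"
  obtains g where "g \<in> generate B4 S" "burau g = shear p k"
proof
  interpret group B4 by (rule group_B4)
  have "subgroup (generate B4 S) B4" by (rule generate_is_subgroup) auto
  \<comment> \<open>The exponent is \<open>- p\<close> because \<open>b\<close> shears
    \<open>s\<close> by -1.\<close>
  then show "b [^]\<^bsub>B4\<^esub> (- p) \<otimes>\<^bsub>B4\<^esub> a [^]\<^bsub>B4\<^esub> k \<in> generate B4 S"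
    using assms by (intro subgroup.m_closed subgroup_int_pow_closed)
  show "burau (b [^]\<^bsub>B4\<^esub> (- p) \<otimes>\<^bsub>B4\<^esub> a [^]\<^bsub>B4\<^esub> k) = shear p k"
    by (simp add: burau_mult burau_int_pow_shear[OF assms(3)] burau_int_pow_shear[OF assms(4)]
        shear_mult)
qed

section \<open>Cosets of the kernel\<close>

lemma carrier_quot_BI4: "carrier (quot_BI4 H) = (\<lambda>g. BI4 #>\<^bsub>B4\<^esub> g) ` H"
  by (auto simp: quot_BI4_def FactGroup_def RCOSETS_def r_coset_def)

text \<open>Homomorphic images commute with generation; applied to the projection, this allows work
  with braids in place of cosets.\<close>

lemma gen_mod_BI4_eq: "gen_mod_BI4 S = (\<lambda>g. BI4 #>\<^bsub>B4\<^esub> g) ` generate B4 S"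
proof -
  have "group_hom B4 (B4 Mod BI4) (\<lambda>g. BI4 #>\<^bsub>B4\<^esub> g)"
    using BI4_normal by (simp add: group_hom_def group_hom_axioms_def group_B4
        normal.factorgroup_is_group normal.r_coset_hom_Mod)
  then show ?thesis
    unfolding gen_mod_BI4_def by (rule group_hom.generate_img) auto
qed

lemma coset_BI4_eqI:
  assumes "burau g = burau h"
  shows "BI4 #>\<^bsub>B4\<^esub> g = BI4 #>\<^bsub>B4\<^esub> h"
proof -
  interpret group B4 by (rule group_B4)
  interpret N: normal BI4 B4 by (rule BI4_normal)
  have "burau (g \<otimes>\<^bsub>B4\<^esub> inv\<^bsub>B4\<^esub> h) = mat 1"
    by (metis assms burau_mult burau_one carrier_B4 r_inv)
  then have "g \<otimes>\<^bsub>B4\<^esub> inv\<^bsub>B4\<^esub> h \<in> BI4"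
    by (simp add: BI4_def kernel_def SL3Z_def)
  then have "g \<in> BI4 #>\<^bsub>B4\<^esub> h"
    by (simp add: N.rcos_module)
  then show ?thesis
    using repr_independence N.is_subgroup by (metis carrier_B4)
qed

text \<open>Criterion shared by the three cases: \<open>a\<close> and \<open>b\<close> produce all
  shears, and \<open>minus\<close> asks for one negating element in the generated subgroup only if
  some braid negates the vector at all.\<close>

lemma quot_BI4_Stab_eq_gen_mod_BI4:
  fixes m n :: int
  assumes n: "n \<ge> 1"
    and S: "S \<subseteq> Stab (homog m n m)"
    and a: "\<tau>\<^sub>1 \<otimes>\<^bsub>B4\<^esub> \<Delta> \<in> generate B4 S" and b: "\<sigma>\<^sub>2 \<in> generate B4 S"
    and minus: "\<And>g. burau g *v vector [m, n, m] = - vector [m, n, m] \<Longrightarrow>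
      \<exists>h\<in>generate B4 S. burau h *v vector [m, n, m] = - vector [m, n, m]"
  shows "carrier (quot_BI4 (Stab (homog m n m))) = gen_mod_BI4 S"
proof -
  interpret group B4 by (rule group_B4)
  let ?v = "vector [m, n, m] :: int^3"
  let ?H = "generate B4 S"
  have sub: "subgroup ?H B4" by (rule generate_is_subgroup) auto
  have "subgroup (Stab (homog m n m)) B4"
    using n by (intro group_action.stabilizer_subgroup[OF burau_group_action] homog_in_P2Q) auto
  with S have "?H \<subseteq> Stab (homog m n m)" by (intro generate_subgroup_incl)
  have plus: "\<exists>h\<in>?H. burau h = burau g" if "burau g *v ?v = ?v" for g
  proof -
    have g: "burau g = shear (burau g $ 2 $ 1) (burau g $ 3 $ 1)"
      using n that by (intro burau_eq_shear) auto
    obtain h where "h \<in> ?H" "burau h = shear (burau g $ 2 $ 1) (burau g $ 3 $ 1)"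
      using shear_in_generate[OF a b burau_\<tau>\<^sub>1_\<Delta> burau_\<sigma>\<^sub>2] .
    with g show ?thesis by metis
  qed
  \<comment> \<open>Multiplying \<open>g\<close> by a negating \<open>h\<close> reduces to the
    factor 1; the resulting \<open>h'\<close> is then divided by \<open>h\<close> again.\<close>
  moreover have "\<exists>h\<in>?H. burau h = burau g" if g: "burau g *v ?v = - ?v" for g
  proof -
    obtain h where h: "h \<in> ?H" "burau h *v ?v = - ?v" using minus[OF g] by blast
    have "burau (g \<otimes>\<^bsub>B4\<^esub> h) *v ?v = burau g *v (- ?v)"
      by (simp add: burau_mult h(2) flip: matrix_vector_mul_assoc)
    also have "\<dots> = - (burau g *v ?v)"
      by (simp add: vec_eq_iff matrix_vector_mult_def sum_negf)
    finally have "burau (g \<otimes>\<^bsub>B4\<^esub> h) *v ?v = ?v" by (simp add: g)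
    from plus[OF this] obtain h' where h': "h' \<in> ?H" "burau h' = burau (g \<otimes>\<^bsub>B4\<^esub> h)"
      by blast
    have "burau (h' \<otimes>\<^bsub>B4\<^esub> inv\<^bsub>B4\<^esub> h) = burau (g \<otimes>\<^bsub>B4\<^esub> h \<otimes>\<^bsub>B4\<^esub> inv\<^bsub>B4\<^esub> h)"
      by (simp add: burau_mult h'(2))
    also have "g \<otimes>\<^bsub>B4\<^esub> h \<otimes>\<^bsub>B4\<^esub> inv\<^bsub>B4\<^esub> h = g" by (simp add: m_assoc)
    finally show ?thesis
      using sub h(1) h'(1) by (meson subgroup.m_closed subgroup.m_inv_closed)
  qed
  ultimately have "\<exists>h\<in>?H. burau g = burau h" if "g \<in> Stab (homog m n m)" for g
    using that unfolding mem_Stab_homog_iff[OF n] by metis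
  then have "BI4 #>\<^bsub>B4\<^esub> g \<in> (\<lambda>h. BI4 #>\<^bsub>B4\<^esub> h) ` ?H" if "g \<in> Stab (homog m n m)" for g
    using that coset_BI4_eqI by blast
  with \<open>?H \<subseteq> Stab (homog m n m)\<close> show ?thesis
    unfolding carrier_quot_BI4 gen_mod_BI4_eq by blast
qed

theorem theorem1p2:
  fixes m n :: int
  assumes "n \<ge> 1" and "0 \<le> m" and "m < n" and "coprime m n"
  shows "carrier (quot_BI4 (Stab (homog m n m))) =
    (if n \<ge> 3 then gen_mod_BI4 {\<tau>\<^sub>1 \<otimes>\<^bsub>B4\<^esub> \<Delta>, \<sigma>\<^sub>2}
     else if n = 2 then gen_mod_BI4 {\<tau>\<^sub>1 \<otimes>\<^bsub>B4\<^esub> \<Delta>, \<sigma>\<^sub>2, \<sigma>\<^sub>1 \<otimes>\<^bsub>B4\<^esub> \<sigma>\<^sub>2 [^]\<^bsub>B4\<^esub> (2::nat) \<otimes>\<^bsub>B4\<^esub> \<sigma>\<^sub>3}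
     else gen_mod_BI4 {\<tau>\<^sub>1, \<Delta>, \<sigma>\<^sub>2})"
proof -
  let ?v = "vector [m, n, m] :: int^3"
  let ?h = "\<sigma>\<^sub>1 \<otimes>\<^bsub>B4\<^esub> \<sigma>\<^sub>2 [^]\<^bsub>B4\<^esub> (2::nat) \<otimes>\<^bsub>B4\<^esub> \<sigma>\<^sub>3"
  have stab: "\<tau>\<^sub>1 \<otimes>\<^bsub>B4\<^esub> \<Delta> \<in> Stab (homog m n m)" "\<sigma>\<^sub>2 \<in> Stab (homog m n m)"
    by (simp_all add: mem_Stab_homog_iff[OF assms(1)] burau_\<tau>\<^sub>1_\<Delta> burau_\<sigma>\<^sub>2 shear_fixes)
  consider "n \<ge> 3" | "n = 2" "m = 1" | "n = 1" "m = 0"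
  proof -
    \<comment> \<open>For \<open>n = 2\<close> the value \<open>m = 0\<close> is excluded by
      coprimality.\<close>
    have "m = 1" if "n = 2"
      using assms that by (cases "m = 0") auto
    then show ?thesis using that assms by (cases "n \<ge> 3"; cases "n = 2") auto
  qed
  then show ?thesis
  proof cases
    case 1
    have "carrier (quot_BI4 (Stab (homog m n m))) = gen_mod_BI4 {\<tau>\<^sub>1 \<otimes>\<^bsub>B4\<^esub> \<Delta>, \<sigma>\<^sub>2}"
    proof (rule quot_BI4_Stab_eq_gen_mod_BI4[OF assms(1)])
      \<comment> \<open>No braid negates the vector here: the first coordinate and coprimality give
        \<open>n dvd 2\<close>, against \<open>n \<ge> 3\<close>.\<close>
      fix g assume "burau g *v ?v = - ?v"
      then have "m + burau g $ 1 $ 2 * n = - m"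
        by (simp add: vec_eq_iff forall_3 matrix_vector_mult_def sum_3 burau_entries algebra_simps)
      then have "m * 2 = n * (- burau g $ 1 $ 2)" by (simp add: algebra_simps)
      then have "n dvd m * 2" by (metis dvd_triv_left)
      then have "n dvd 2"
        using assms(4) by (simp add: coprime_dvd_mult_right_iff coprime_commute)
      then have False using 1 zdvd_imp_le[of n 2] by simp
      then show "\<exists>h\<in>generate B4 {\<tau>\<^sub>1 \<otimes>\<^bsub>B4\<^esub> \<Delta>, \<sigma>\<^sub>2}. burau h *v ?v = - ?v" ..
    qed (use stab in \<open>auto intro: generate.incl\<close>)
    with 1 show ?thesis by simp
  next
    case 2
    have h: "burau ?h *v ?v = - ?v"
      unfolding burau_\<sigma>\<^sub>1\<sigma>\<^sub>2\<sigma>\<^sub>2\<sigma>\<^sub>3 2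
      by (simp add: vec_eq_iff forall_3 matrix_vector_mult_def sum_3)
    then have "?h \<in> Stab (homog m n m)"
      unfolding mem_Stab_homog_iff[OF assms(1)] by (rule disjI2)
    with stab have "carrier (quot_BI4 (Stab (homog m n m))) = gen_mod_BI4 {\<tau>\<^sub>1 \<otimes>\<^bsub>B4\<^esub> \<Delta>, \<sigma>\<^sub>2, ?h}"
      by (intro quot_BI4_Stab_eq_gen_mod_BI4[OF assms(1)] bexI[of _ ?h] h)
         (auto intro: generate.incl)
    with 2 show ?thesis by simp
  next
    case 3
    have h: "burau \<tau>\<^sub>1 *v ?v = - ?v" "burau \<Delta> *v ?v = - ?v"
      unfolding burau_\<tau>\<^sub>1 burau_\<Delta> 3
      by (simp_all add: vec_eq_iff forall_3 matrix_vector_mult_def sum_3)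
    then have "{\<tau>\<^sub>1, \<Delta>, \<sigma>\<^sub>2} \<subseteq> Stab (homog m n m)"
      using stab mem_Stab_homog_iff[OF assms(1)] by blast
    \<comment> \<open>The shear braid is the product of the first two generators, and
      \<open>\<tau>\<^sub>1\<close> serves as the negating element.\<close>
    then have "carrier (quot_BI4 (Stab (homog m n m))) = gen_mod_BI4 {\<tau>\<^sub>1, \<Delta>, \<sigma>\<^sub>2}"
      by (intro quot_BI4_Stab_eq_gen_mod_BI4[OF assms(1)] bexI[of _ \<tau>\<^sub>1] h(1))
         (auto intro: generate.incl generate.eng)
    with 3 show ?thesis by simp
  qed
qed

end
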